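(* Let $r^0_n=r^0_n(u)$, $n\in\mathbb{Z}$, be the octahedral functions with upper index $m=0$, defined in the context. For any $n\in\mathbb{Z}$, $r^0_n$ has the Heun representation $$r^0_n(u)=Hn\!\left(\left(\tfrac{2+\sqrt3}{2-\sqrt3}\right)^2,\ \tfrac{9(2+\sqrt3)^2\,n(12n+1)}{4};\ -3n,\,-\tfrac14-3n;\ \tfrac34,\,-3n;\ -(2+\sqrt3)^2u\right)$$ and the equivalent expansion $r^0_n(u)=\sum_{k=0}^\infty a_ku^k$ (near $u=0$), where $\{a_k\}_{k=0}^\infty$ satisfy, for $k\ge 0$, the second-order recurrence $$(k+1)(4k+3)\,a_{k+1}+\left[14k(4k-12n-1)+9n(12n+1)\right]a_k+(k-3n-1)(4k-12n-5)\,a_{k-1}=0,$$ with $a_0=1$, $a_{-1}=0$. Thus when $n\ge0$, $r^0_n$ is a degree-$3n$ Heun polynomial.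
   Context: The Heun function $Hn(a,q;\alpha,\beta;\gamma,\delta;z)$ is the solution, analytic at $z=0$ with value $1$ there, of the Heun equation $$w''+\left[\frac\gamma z+\frac\delta{z-1}+\frac{\epsilon}{z-a}\right]w'+\frac{\alpha\beta z-q}{z(z-1)(z-a)}\,w=0,\qquad \epsilon=\alpha+\beta+1-\gamma-\delta.$$ A Heun polynomial is a Heun function that is a polynomial in its argument. Octahedral functions: let $p_{\rm v}(u)=u(1-u)^4$, $p_{\rm e}(u)=(1+u)(1-34u+u^2)$, $p_{\rm f}(u)=1+14u+u^2$, and $R(u)=-108\,p_{\rm v}(u)/p_{\rm e}(u)^2=1-p_{\rm f}(u)^3/p_{\rm e}(u)^2$. For $n\in\mathbb{Z}$, $r^0_n$ is the rational function of $u$ that on a neighborhood of $u=0$ satisfies $${}_2F_1\!\left(-\tfrac1{24}-\tfrac n2,\ \tfrac{11}{24}-\tfrac n2;\ \tfrac34;\ R(u)\right)=p_{\rm e}(u)^{-1/12-n}\,r^0_n(u)$$ (with powers of $p_{\rm e}(u)$ equal to $1$ at $u=0$), ${}_2F_1$ being the Gauss function. *)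

theory Defs
  imports "HOL-Complex_Analysis.Complex_Analysis"
begin

definition heun_equation ::
  "complex \<Rightarrow> complex \<Rightarrow> complex \<Rightarrow> complex \<Rightarrow> complex \<Rightarrow> complex \<Rightarrow> (complex \<Rightarrow> complex) \<Rightarrow> complex \<Rightarrow> bool"
where
  "heun_equation a q \<alpha> \<beta> \<gamma> \<delta> w z \<longleftrightarrow>
     (let \<epsilon> = \<alpha> + \<beta> + 1 - \<gamma> - \<delta> in
       deriv (deriv w) z + (\<gamma> / z + \<delta> / (z - 1) + \<epsilon> / (z - a)) * deriv w z
         + (\<alpha> * \<beta> * z - q) / (z * (z - 1) * (z - a)) * w z = 0)"

(* The singular point z = 0 is excluded: division by 0 yields 0, so the equation
   would be meaningless there. *)
definition local_heun_solution ::
  "complex \<Rightarrow> complex \<Rightarrow> complex \<Rightarrow> complex \<Rightarrow> complex \<Rightarrow> complex \<Rightarrow> (complex \<Rightarrow> complex) \<Rightarrow> bool"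
where
  "local_heun_solution a q \<alpha> \<beta> \<gamma> \<delta> w \<longleftrightarrow>
     w analytic_on {0} \<and> w 0 = 1 \<and> (\<forall>\<^sub>F z in at 0. heun_equation a q \<alpha> \<beta> \<gamma> \<delta> w z)"

(* An analytic solution is determined only as a germ at 0. Hn is the sum of its
   Taylor series, i.e. the solution itself on the disk of convergence (the whole plane
   if the solution is a polynomial). The series is unique if \<gamma> is not in {0, -1, -2, ...}
   and a is not 0. *)
definition Hn ::
  "complex \<Rightarrow> complex \<Rightarrow> complex \<Rightarrow> complex \<Rightarrow> complex \<Rightarrow> complex \<Rightarrow> complex \<Rightarrow> complex"
where
  "Hn a q \<alpha> \<beta> \<gamma> \<delta> =
     eval_fps (THE F. \<exists>w. local_heun_solution a q \<alpha> \<beta> \<gamma> \<delta> w \<and> w has_fps_expansion F)"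

definition is_Heun_polynomial ::
  "complex \<Rightarrow> complex \<Rightarrow> complex \<Rightarrow> complex \<Rightarrow> complex \<Rightarrow> complex \<Rightarrow> complex poly \<Rightarrow> bool"
where
  "is_Heun_polynomial a q \<alpha> \<beta> \<gamma> \<delta> H \<longleftrightarrow> (\<forall>z. Hn a q \<alpha> \<beta> \<gamma> \<delta> z = poly H z)"

definition gauss_2F1 :: "complex \<Rightarrow> complex \<Rightarrow> complex \<Rightarrow> complex \<Rightarrow> complex" where
  "gauss_2F1 a b c = eval_fps (fps_hypergeo [a, b] [c] 1)"

definition p_v :: "complex \<Rightarrow> complex" where
  "p_v u = u * (1 - u) ^ 4"

definition p_e :: "complex \<Rightarrow> complex" where
  "p_e u = (1 + u) * (1 - 34 * u + u ^ 2)"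

definition p_f :: "complex \<Rightarrow> complex" where
  "p_f u = 1 + 14 * u + u ^ 2"

definition oct_R :: "complex \<Rightarrow> complex" where
  "oct_R u = - 108 * p_v u / p_e u ^ 2"

lemma oct_R_alt:
  assumes "p_e u \<noteq> 0"
  shows "oct_R u = 1 - p_f u ^ 3 / p_e u ^ 2"
proof -
  have "p_e u ^ 2 - p_f u ^ 3 = - 108 * p_v u"
    unfolding p_e_def p_f_def p_v_def by algebra
  then show ?thesis
    using assms unfolding oct_R_def by (simp add: field_simps)
qed

(* Rational functions as functions on the plane. The quotient is in lowest terms, so
   the function has the value 0 exactly at its zeros and, by the convention x / 0 = 0,
   at its poles. In particular it is determined by its germ at any point. *)
definition rational_function :: "(complex \<Rightarrow> complex) \<Rightarrow> bool" where
  "rational_function r \<longleftrightarrow>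
     (\<exists>p q. q \<noteq> 0 \<and> coprime p q \<and> (\<forall>u. r u = poly p u / poly q u))"

(* The principal branch of powr is the required one: p_e 0 = 1, so it is analytic
   near u = 0 and equal to 1 at u = 0. *)
definition octahedral_r0 :: "int \<Rightarrow> complex \<Rightarrow> complex" where
  "octahedral_r0 n = (THE r. rational_function r \<and>
     (\<forall>\<^sub>F u in nhds 0.
        gauss_2F1 (- 1 / 24 - of_int n / 2) (11 / 24 - of_int n / 2) (3 / 4) (oct_R u)
          = p_e u powr (- 1 / 12 - of_int n) * r u))"

end

(* Write G_n for the Taylor series at u = 0 of p_e^(1/12+n) 2F1(-1/24-n/2, 11/24-n/2; 3/4; R(u)).
   Replacing n by n - 1 or n + 1 exchanges the two upper parameters of the Gauss function, up to
   a shift of one of them by 1. Gauss' two contiguity relations, pulled back along R, therefore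
   express G_{n-1} and G_{n+1} through G_n and G_n' with polynomial coefficients in u, apart from
   a denominator p_f^2 in the lowering relation. Eliminating G_{n-1} from the two relations gives
   a second order equation for G_n, which is the three-term recurrence and, after scaling u, the
   Heun equation. For n = 0 the recurrence forces G_0 = 1, so that the raising and lowering
   relations make every G_n rational. The raising relation also shows that G_n is a polynomial
   of degree 3n if n >= 0: the leading coefficient is multiplied by (13 + 12 n) / (7 + 12 n)
   in the step from n to n + 1. *)

theory Submission
  imports Defs "HOL-Computational_Algebra.Field_as_Ring" "HOL-Computational_Algebra.Polynomial_Factorial"
begin

unbundle no vec_syntax

subsection \<open>The Gauss hypergeometric series\<close>

text \<open>Coefficientwise this is
  \<open>a * pochhammer (a + 1) k = (a + k) * pochhammer a k\<close>, since
  \<open>fps_X * fps_deriv\<close> multiplies the coefficient of index \<open>k\<close> by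
  \<open>k\<close>.\<close>

lemma fps_hypergeo_contiguous_up:
  fixes a b c :: "'a::field_char_0"
  shows "fps_const a * fps_hypergeo [a + 1, b] [c] 1
    = fps_const a * fps_hypergeo [a, b] [c] 1 + fps_X * fps_deriv (fps_hypergeo [a, b] [c] 1)"
proof (rule fps_ext)
  fix k
  have "a * pochhammer (a + 1) k = (a + of_nat k) * pochhammer a k"
    by (metis pochhammer_rec pochhammer_rec')
  then have "a * (pochhammer (a + 1) k * pochhammer b k) = (a + of_nat k) * (pochhammer a k * pochhammer b k)"
    by (metis mult.assoc)
  then show "(fps_const a * fps_hypergeo [a + 1, b] [c] 1) $ k
      = (fps_const a * fps_hypergeo [a, b] [c] 1 + fps_X * fps_deriv (fps_hypergeo [a, b] [c] 1)) $ k"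
    by (cases k) (auto simp: add_divide_distrib[symmetric] algebra_simps simp del: of_nat_Suc)
qed

text \<open>In the coefficient of index \<open>Suc j\<close>, every hypergeometric coefficient that
  occurs is a rational multiple of \<open>Q\<close>, the one of index \<open>j\<close>, so that only
  a rational identity in \<open>a\<close>, \<open>b\<close>, \<open>c\<close> and \<open>j\<close>
  is left.\<close>

lemma fps_hypergeo_contiguous_down:
  fixes a b c :: "'a::field_char_0"
  assumes "c \<notin> \<int>\<^sub>\<le>\<^sub>0"
  shows "fps_const (c - b) * fps_hypergeo [a, b - 1] [c] 1
    = fps_X * (1 - fps_X) * fps_deriv (fps_hypergeo [a, b] [c] 1)
      + (fps_const (c - b) - fps_const a * fps_X) * fps_hypergeo [a, b] [c] 1"
proof (rule fps_ext)
  fix k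
  show "(fps_const (c - b) * fps_hypergeo [a, b - 1] [c] 1) $ k
    = (fps_X * (1 - fps_X) * fps_deriv (fps_hypergeo [a, b] [c] 1)
      + (fps_const (c - b) - fps_const a * fps_X) * fps_hypergeo [a, b] [c] 1) $ k"
  proof (cases k)
    case 0
    then show ?thesis by (simp add: mult.assoc)
  next
    case (Suc j)
    let ?f = "fps_hypergeo [a, b] [c] 1" and ?j = "of_nat j :: 'a"
    define Q where "Q = pochhammer a j * pochhammer b j / (pochhammer c j * fact j)"
    have c: "c + ?j \<noteq> 0"
      using assms by (metis add_eq_0_iff minus_of_nat_in_nonpos_Ints add.commute)
    have j: "1 + ?j \<noteq> 0"
      by (metis of_nat_Suc of_nat_neq_0)
    have fact: "fact (Suc j) = (1 + ?j) * fact j"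
      by simp
    have f: "?f $ j = Q"
      by (simp add: Q_def)
    have fS: "?f $ Suc j = (a + ?j) * (b + ?j) / ((c + ?j) * (1 + ?j)) * Q"
      by (simp add: Q_def pochhammer_Suc fact mult_ac del: fact_Suc)
    have fm: "fps_hypergeo [a, b - 1] [c] 1 $ Suc j = (a + ?j) * (b - 1) / ((c + ?j) * (1 + ?j)) * Q"
      by (simp add: Q_def pochhammer_Suc[of a] pochhammer_Suc[of c] pochhammer_rec[of "b - 1"] fact mult_ac del: fact_Suc)
    have "(c - b) * (fps_hypergeo [a, b - 1] [c] 1 $ Suc j)
        = (1 + ?j) * (?f $ Suc j) - ?j * (?f $ j) + (c - b) * (?f $ Suc j) - a * (?f $ j)"
      unfolding f fS fm using c j by (simp add: divide_simps) algebra
    moreover have "(fps_X * (1 - fps_X) * fps_deriv ?f + (fps_const (c - b) - fps_const a * fps_X) * ?f) $ Suc j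
        = (1 + ?j) * (?f $ Suc j) - ?j * (?f $ j) + (c - b) * (?f $ Suc j) - a * (?f $ j)"
      by (cases j) (simp_all add: left_diff_distrib mult.assoc del: fps_hypergeo_nth)
    ultimately show ?thesis
      using Suc by (simp del: fps_hypergeo_nth)
  qed
qed

lemma tendsto_add_of_nat_ratio:
  fixes a c :: complex
  shows "(\<lambda>n. (c + of_nat n) / (a + of_nat n)) \<longlonglongrightarrow> 1"
proof -
  have inf: "filterlim (\<lambda>n. a + of_nat n) at_infinity sequentially"
    by (intro tendsto_add_filterlim_at_infinity[OF tendsto_const] tendsto_of_nat)
  have "(\<lambda>n. 1 + (c - a) / (a + of_nat n)) \<longlonglongrightarrow> 1 + 0"
    by (intro tendsto_intros tendsto_divide_0[OF tendsto_const] inf)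
  moreover have "\<forall>\<^sub>F n in sequentially. a + of_nat n \<noteq> 0"
    using inf by (rule filterlim_at_infinity_imp_eventually_ne)
  then have "\<forall>\<^sub>F n in sequentially. 1 + (c - a) / (a + of_nat n) = (c + of_nat n) / (a + of_nat n)"
    by eventually_elim (simp add: field_simps)
  ultimately show ?thesis
    by (simp add: tendsto_cong)
qed

text \<open>The ratio test: the conditions on \<open>a\<close> and \<open>b\<close> keep the series
  from terminating, and quotients of successive coefficients tend to 1.\<close>

lemma fps_conv_radius_2F1:
  fixes a b c :: complex
  assumes "a \<notin> \<int>\<^sub>\<le>\<^sub>0" "b \<notin> \<int>\<^sub>\<le>\<^sub>0" "c \<notin> \<int>\<^sub>\<le>\<^sub>0"
  shows "fps_conv_radius (fps_hypergeo [a, b] [c] 1) = 1"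
proof -
  let ?f = "fps_hypergeo [a, b] [c] 1"
  have ne: "x + of_nat n \<noteq> 0" if "x \<notin> \<int>\<^sub>\<le>\<^sub>0" for x :: complex and n
    using that by (metis add_eq_0_iff minus_of_nat_in_nonpos_Ints add.commute)
  have nz: "?f $ n \<noteq> 0" for n
  proof (induction n)
    case (Suc n)
    then show ?case
      unfolding fps_hypergeo_rec using ne assms by (simp del: fps_hypergeo_nth of_nat_Suc)
  qed simp
  have ratio: "?f $ n / ?f $ Suc n = (c + of_nat n) / (a + of_nat n) * ((1 + of_nat n) / (b + of_nat n))" for n
    using nz[of n] ne[OF assms(1)] ne[OF assms(2)] ne[OF assms(3)]
    unfolding fps_hypergeo_rec by (simp add: divide_simps del: fps_hypergeo_nth)
  have "(\<lambda>n. ?f $ n / ?f $ Suc n) \<longlonglongrightarrow> 1 * 1"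
    unfolding ratio by (intro tendsto_mult tendsto_add_of_nat_ratio)
  then have "(\<lambda>n. norm (?f $ n) / norm (?f $ Suc n)) \<longlonglongrightarrow> 1"
    using tendsto_norm by (fastforce simp: norm_divide simp del: fps_hypergeo_nth)
  then show ?thesis
    unfolding fps_conv_radius_def by (intro conv_radius_ratio_limit_nonzero[of _ 1]) auto
qed

subsection \<open>Pullback along the octahedral function\<close>

definition pv :: "complex fps" where
  "pv = fps_X * (1 - fps_X) ^ 4"

definition pe :: "complex fps" where
  "pe = (1 + fps_X) * (1 - 34 * fps_X + fps_X ^ 2)"

definition pf :: "complex fps" where
  "pf = 1 + 14 * fps_X + fps_X ^ 2"

definition octR :: "complex fps" where
  "octR = - 108 * pv / pe ^ 2"

text \<open>The branch of p_e^c with constant term 1: the binomial series (1 + X)^c at X =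
  \<open>pe - 1\<close>.\<close>

definition pe_powr :: "complex \<Rightarrow> complex fps" where
  "pe_powr c = fps_binomial c oo (pe - 1)"

definition hypF :: "complex \<Rightarrow> complex fps" where
  "hypF N = fps_hypergeo [- 1 / 24 - N / 2, 11 / 24 - N / 2] [3 / 4] 1"

text \<open>The series G_n with a complex \<open>N\<close> in place of n; the outer factor cancels
  the power of p_e in the definition of r^0_n.\<close>

definition octG :: "complex \<Rightarrow> complex fps" where
  "octG N = pe_powr (1 / 12 + N) * (hypF N oo octR)"

lemma pe_nth_0: "pe $ 0 = 1" and pf_nth_0: "pf $ 0 = 1"
  by (simp_all add: pe_def pf_def)

lemma pe_nonzero: "pe \<noteq> 0" and pf_nonzero: "pf \<noteq> 0"
  using pe_nth_0 pf_nth_0 by force+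

lemma fps_deriv_pe: "fps_deriv pe = 3 * fps_X ^ 2 - 66 * fps_X - 33"
  unfolding pe_def by (simp add: algebra_simps power2_eq_square)

lemma fps_deriv_pf: "fps_deriv pf = 14 + 2 * fps_X"
  unfolding pf_def by (simp add: algebra_simps power2_eq_square)

lemma octR_mult: "octR * pe ^ 2 = - 108 * pv"
  unfolding octR_def by (simp add: pe_nth_0 fps_divide_times_eq)

lemma octR_nth_0: "octR $ 0 = 0"
  unfolding octR_def by (simp add: pe_nth_0 pv_def fps_divide_nth_0)

text \<open>Rests on the octahedral syzygy between the vertex, edge and face polynomials.\<close>

lemma octR_one_minus: "(1 - octR) * pe ^ 2 = pf ^ 3"
proof -
  have "pe ^ 2 - pf ^ 3 = - 108 * pv"
    unfolding pe_def pf_def pv_def by algebra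
  then show ?thesis
    using octR_mult by algebra
qed

text \<open>The logarithmic derivative of R, cleared of denominators. As 1 - R = p_f^3 / p_e^2, the
  value 1 is taken with multiplicity three at the zeros of p_f, whence the factor p_f^2 in
  R'.\<close>

lemma octR_deriv: "octR * pf ^ 2 = fps_X * (1 - fps_X) * pe * fps_deriv octR"
proof -
  have "pv = fps_X * ((1 - fps_X) * (1 - fps_X) * ((1 - fps_X) * (1 - fps_X)))"
    unfolding pv_def by algebra
  then have "fps_deriv pv = fps_deriv (fps_X * ((1 - fps_X) * (1 - fps_X) * ((1 - fps_X) * (1 - fps_X))))"
    by simp
  then have "fps_deriv pv = (1 - fps_X) * (1 - fps_X) * (1 - fps_X) * (1 - 5 * fps_X)"
    by simp
  moreover have "fps_deriv (octR * pe ^ 2) = fps_deriv (- 108 * pv)"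
    by (simp add: octR_mult)
  then have "fps_deriv octR * pe ^ 2 + 2 * octR * pe * fps_deriv pe = - 108 * fps_deriv pv"
    by (simp add: fps_deriv_power algebra_simps power2_eq_square)
  ultimately have d: "fps_deriv octR * pe ^ 2 + 2 * octR * pe * fps_deriv pe
      = - 108 * ((1 - fps_X) * (1 - fps_X) * (1 - fps_X) * (1 - 5 * fps_X))"
    by (simp only:)
  \<comment> \<open>The numerator p_e p_v' - 2 p_e' p_v of the logarithmic derivative of p_v /
    p_e^2, factored.\<close>
  have e: "pe * ((1 - fps_X) * (1 - fps_X) * (1 - fps_X) * (1 - 5 * fps_X)) - 2 * fps_deriv pe * pv = (1 - fps_X) ^ 3 * pf ^ 2"
    unfolding fps_deriv_pe unfolding pe_def pf_def pv_def by algebra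
  have "pe ^ 2 * (octR * pf ^ 2) = pe ^ 2 * (fps_X * (1 - fps_X) * pe * fps_deriv octR)"
    using octR_mult d e pv_def by algebra
  then show ?thesis
    using pe_nonzero by simp
qed

text \<open>The binomial series B satisfies (1 + X) B' = c B; substitute \<open>pe - 1\<close> for X
  and apply the chain rule.\<close>

lemma pe_powr_deriv: "pe * fps_deriv (pe_powr c) = fps_const c * fps_deriv pe * pe_powr c"
proof -
  have 0: "(pe - 1) $ 0 = 0"
    by (simp add: pe_nth_0)
  have "(1 + fps_X) * fps_deriv (fps_binomial c) = fps_const c * fps_binomial c"
    unfolding fps_binomial_deriv by simp
  then have "((1 + fps_X) * fps_deriv (fps_binomial c)) oo (pe - 1) = (fps_const c * fps_binomial c) oo (pe - 1)"
    by simp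
  then have "pe * (fps_deriv (fps_binomial c) oo (pe - 1)) = fps_const c * pe_powr c"
    using 0 by (simp add: fps_compose_mult_distrib fps_compose_add_distrib pe_powr_def)
  then show ?thesis
    unfolding pe_powr_def fps_compose_deriv[OF 0] by simp
qed

lemma pe_powr_add_one: "pe_powr (c + 1) = pe * pe_powr c"
  by (simp add: pe_powr_def fps_binomial_add_mult fps_binomial_1 fps_compose_mult_distrib
      fps_compose_add_distrib pe_nth_0)

section \<open>Raising and lowering the index\<close>

lemma hypF_lower:
  "fps_const (1 + 12 * N) * hypF (N - 1) = fps_const (1 + 12 * N) * hypF N - 24 * fps_X * fps_deriv (hypF N)"
proof -
  have c: "fps_const (1 + 12 * N) = - 24 * fps_const (- 1 / 24 - N / 2)"
    by (simp add: numeral_fps_const algebra_simps flip: fps_const_neg)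
  \<comment> \<open>With a = -1/24 - N/2 and b = 11/24 - N/2, the upper parameters for
    \<open>N - 1\<close> are b and a + 1, and their order is immaterial.\<close>
  have s: "hypF (N - 1) = fps_hypergeo [(- 1 / 24 - N / 2) + 1, 11 / 24 - N / 2] [3 / 4] 1"
    unfolding hypF_def by (rule fps_ext) (simp add: algebra_simps add_divide_distrib diff_divide_distrib)
  have "fps_const (- 1 / 24 - N / 2) * hypF (N - 1)
      = fps_const (- 1 / 24 - N / 2) * hypF N + fps_X * fps_deriv (hypF N)"
    unfolding s unfolding hypF_def by (rule fps_hypergeo_contiguous_up)
  then show ?thesis
    unfolding c by algebra
qed

lemma hypF_raise:
  "fps_const (7 + 12 * N) * hypF (N + 1)
    = 24 * fps_X * (1 - fps_X) * fps_deriv (hypF N)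
      + (fps_const (7 + 12 * N) + fps_const (1 + 12 * N) * fps_X) * hypF N"
proof -
  have c: "fps_const (1 + 12 * N) = - 24 * fps_const (- 1 / 24 - N / 2)"
    by (simp add: numeral_fps_const algebra_simps flip: fps_const_neg)
  have c': "fps_const (7 + 12 * N) = 24 * fps_const (3 / 4 - (11 / 24 - N / 2))"
    by (simp add: numeral_fps_const algebra_simps)
  \<comment> \<open>In the same notation, the upper parameters for \<open>N + 1\<close> are b - 1
    and a.\<close>
  have s: "hypF (N + 1) = fps_hypergeo [- 1 / 24 - N / 2, (11 / 24 - N / 2) - 1] [3 / 4] 1"
  proof -
    have "- 1 / 24 - (N + 1) / 2 = 11 / 24 - N / 2 - 1" "11 / 24 - (N + 1) / 2 = - 1 / 24 - N / 2"
      by (simp_all add: field_simps)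
    then show ?thesis
      unfolding hypF_def by (simp only:) (rule fps_ext, simp add: mult_ac)
  qed
  have nn: "(3 / 4 :: complex) \<notin> \<int>\<^sub>\<le>\<^sub>0"
    by (auto elim!: nonpos_Ints_cases simp: complex_eq_iff)
  have "fps_const (3 / 4 - (11 / 24 - N / 2)) * hypF (N + 1)
      = fps_X * (1 - fps_X) * fps_deriv (hypF N)
        + (fps_const (3 / 4 - (11 / 24 - N / 2)) - fps_const (- 1 / 24 - N / 2) * fps_X) * hypF N"
    unfolding s unfolding hypF_def by (rule fps_hypergeo_contiguous_down[OF nn])
  then show ?thesis
    unfolding c c' by algebra
qed


text \<open>Compose \<open>hypF_lower\<close> with R and multiply by p_e^(1/12 + N). The chain rule
  trades \<open>D\<close> for \<open>fps_deriv K\<close>, and by \<open>octR_deriv\<close> the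
  quotient R / R' is X (1 - X) p_e / p_f^2, which puts p_f^2 on the left.\<close>

lemma octG_lower:
  "fps_const (1 + 12 * N) * pf ^ 2 * octG (N - 1)
    = fps_const (1 + 12 * N) * (1 - 5 * fps_X) * octG N - 24 * fps_X * (1 - fps_X) * fps_deriv (octG N)"
proof -
  define m where "m = fps_const (1 + 12 * N)"
  define E where "E = pe_powr (1 / 12 + N)"
  define K where "K = hypF N oo octR"
  define K' where "K' = hypF (N - 1) oo octR"
  define D where "D = fps_deriv (hypF N) oo octR"
  have K': "m * K' = m * K - 24 * octR * D"
    using arg_cong[OF hypF_lower[of N], of "\<lambda>f. f oo octR"] octR_nth_0
    by (simp add: m_def K_def K'_def D_def fps_compose_mult_distrib fps_compose_sub_distrib)
  have dK: "fps_deriv K = D * fps_deriv octR"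
    using octR_nth_0 by (simp add: K_def D_def fps_compose_deriv)
  define e where "e = fps_const (1 / 12 + N)"
  have "12 * e = m"
    by (simp add: m_def e_def numeral_fps_const algebra_simps)
  moreover have "pe * fps_deriv E = e * fps_deriv pe * E"
    unfolding E_def e_def by (rule pe_powr_deriv)
  ultimately have dE: "12 * pe * fps_deriv E = m * fps_deriv pe * E"
    by (metis mult.assoc)
  have G: "octG N = E * K"
    by (simp add: octG_def E_def K_def)
  have "pe_powr (1 / 12 + N) = pe * pe_powr (1 / 12 + (N - 1))"
    using pe_powr_add_one[of "1 / 12 + (N - 1)"] by (simp add: algebra_simps)
  then have G': "pe * octG (N - 1) = E * K'"
    by (simp add: octG_def E_def K'_def)
  have dG: "fps_deriv (octG N) = fps_deriv E * K + E * fps_deriv K"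
    by (simp add: G)
  \<comment> \<open>Makes the coefficient of \<open>octG N\<close> divisible by \<open>pe\<close>,
    so that \<open>pe\<close> can be cancelled at the end.\<close>
  have p: "pf ^ 2 + 2 * fps_X * (1 - fps_X) * fps_deriv pe = pe * (1 - 5 * fps_X)"
    unfolding fps_deriv_pe unfolding pe_def pf_def by algebra
  have "pe * (m * pf ^ 2 * octG (N - 1))
      = m * pf ^ 2 * E * K - 24 * fps_X * (1 - fps_X) * pe * E * fps_deriv K"
    using K' dK G' octR_deriv by algebra
  also have "\<dots> = pe * (m * (1 - 5 * fps_X) * octG N - 24 * fps_X * (1 - fps_X) * fps_deriv (octG N))"
    using dE dG G p by algebra
  finally show ?thesis
    using pe_nonzero by (simp add: m_def)
qed

text \<open>The same pullback, but now 1 - R = p_f^3 / p_e^2 accompanies R / R', and p_f^3 absorbs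
  the denominator p_f^2. Only constants remain on the left, which is why raising preserves
  polynomials.\<close>

lemma octG_raise:
  "fps_const (7 + 12 * N) * octG (N + 1)
    = 24 * fps_X * (1 - fps_X) * pf * fps_deriv (octG N)
      + (fps_const (7 + 12 * N) * pe - 6 * fps_const (1 + 12 * N) * fps_X * (1 - fps_X) * (7 + fps_X)) * octG N"
proof -
  define m where "m = fps_const (1 + 12 * N)"
  define l where "l = fps_const (7 + 12 * N)"
  define E where "E = pe_powr (1 / 12 + N)"
  define K where "K = hypF N oo octR"
  define K' where "K' = hypF (N + 1) oo octR"
  define D where "D = fps_deriv (hypF N) oo octR"
  have K': "l * K' = 24 * octR * (1 - octR) * D + (l + m * octR) * K"
    using arg_cong[OF hypF_raise[of N], of "\<lambda>f. f oo octR"] octR_nth_0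
    by (simp add: l_def m_def K_def K'_def D_def fps_compose_mult_distrib fps_compose_sub_distrib
        fps_compose_add_distrib)
  have dK: "fps_deriv K = D * fps_deriv octR"
    using octR_nth_0 by (simp add: K_def D_def fps_compose_deriv)
  define e where "e = fps_const (1 / 12 + N)"
  have "12 * e = m"
    by (simp add: m_def e_def numeral_fps_const algebra_simps)
  moreover have "pe * fps_deriv E = e * fps_deriv pe * E"
    unfolding E_def e_def by (rule pe_powr_deriv)
  ultimately have dE: "12 * pe * fps_deriv E = m * fps_deriv pe * E"
    by (metis mult.assoc)
  have G: "octG N = E * K"
    by (simp add: octG_def E_def K_def)
  have "pe_powr (1 / 12 + (N + 1)) = pe * pe_powr (1 / 12 + N)"
    using pe_powr_add_one[of "1 / 12 + N"] by (simp add: algebra_simps)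
  then have G': "octG (N + 1) = pe * E * K'"
    by (simp add: octG_def E_def K'_def)
  have dG: "fps_deriv (octG N) = fps_deriv E * K + E * fps_deriv K"
    by (simp add: G)
  have p: "108 * pv + 2 * fps_X * (1 - fps_X) * pf * fps_deriv pe
      = pe * (6 * fps_X * (1 - fps_X) * (7 + fps_X))"
    unfolding fps_deriv_pe unfolding pe_def pf_def pv_def by algebra
  \<comment> \<open>The factor \<open>pf ^ 2\<close> makes \<open>octR_deriv\<close> applicable and
    is cancelled afterwards.\<close>
  have "pf ^ 2 * (pe * (octR * (1 - octR) * D)) = pf ^ 2 * (fps_X * (1 - fps_X) * pf * fps_deriv K)"
  proof -
    have "pf ^ 2 * (pe * (octR * (1 - octR) * D)) = fps_X * (1 - fps_X) * ((1 - octR) * pe ^ 2) * fps_deriv K"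
      using octR_deriv dK by algebra
    then show ?thesis
      unfolding octR_one_minus by algebra
  qed
  then have RD: "pe * (octR * (1 - octR) * D) = fps_X * (1 - fps_X) * pf * fps_deriv K"
    using pf_nonzero by simp
  have "pe * (l * octG (N + 1))
      = 24 * fps_X * (1 - fps_X) * pf * pe * E * fps_deriv K + (l * pe ^ 2 - 108 * m * pv) * E * K"
    using K' RD G' octR_mult by algebra
  also have "\<dots> = pe * (24 * fps_X * (1 - fps_X) * pf * fps_deriv (octG N)
      + (l * pe - 6 * m * fps_X * (1 - fps_X) * (7 + fps_X)) * octG N)"
    using dE dG G p by algebra
  finally show ?thesis
    using pe_nonzero by (simp add: m_def l_def)
qed

text \<open>Lowering from \<open>N\<close> to \<open>N - 1\<close> and raising again returns to
  \<open>octG N\<close>. Both relations are of first order, so their composite is an equation of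
  second order.\<close>

lemma octG_ode:
  assumes "1 + 12 * N \<noteq> 0"
  defines "c \<equiv> fps_const N"
  shows "4 * fps_X * pf * fps_deriv (fps_deriv (octG N))
    + (3 + 14 * (3 - 12 * c) * fps_X + (3 - 24 * c) * fps_X ^ 2) * fps_deriv (octG N)
    + (9 * c * (12 * c + 1) + 3 * c * (12 * c + 1) * fps_X) * octG N = 0"
    (is "?ode = 0")
proof -
  define m where "m = fps_const (1 + 12 * N)"
  define G where "G = octG N"
  define H where "H = octG (N - 1)"
  have m: "m = 1 + 12 * c" and m0: "m \<noteq> 0"
    using assms by (simp_all add: m_def c_def numeral_fps_const flip: fps_const_1_eq_1)
  have low: "m * pf ^ 2 * H = m * (1 - 5 * fps_X) * G - 24 * fps_X * (1 - fps_X) * fps_deriv G"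
    using octG_lower[of N] by (simp add: m_def G_def H_def)
  then have "fps_deriv (m * pf ^ 2 * H)
      = fps_deriv (m * (1 - 5 * fps_X) * G - 24 * fps_X * (1 - fps_X) * fps_deriv G)"
    by simp
  then have dlow: "m * pf ^ 2 * fps_deriv H + 2 * m * pf * (14 + 2 * fps_X) * H
      = m * (1 - 5 * fps_X) * fps_deriv G - 5 * m * G - 24 * (1 - 2 * fps_X) * fps_deriv G
        - 24 * fps_X * (1 - fps_X) * fps_deriv (fps_deriv G)"
    by (simp add: m_def fps_deriv_power fps_deriv_pf algebra_simps power2_eq_square)
  have "fps_const (7 + 12 * (N - 1)) = m - 6" "fps_const (1 + 12 * (N - 1)) = m - 12"
    by (simp_all add: m_def numeral_fps_const algebra_simps)
  then have up: "(m - 6) * G = 24 * fps_X * (1 - fps_X) * pf * fps_deriv H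
      + ((m - 6) * pe - 6 * (m - 12) * fps_X * (1 - fps_X) * (7 + fps_X)) * H"
    using octG_raise[of "N - 1"] by (simp add: G_def H_def)
  \<comment> \<open>This is \<open>up\<close> times \<open>m * pf ^ 2\<close>: \<open>H\<close> and
    \<open>fps_deriv H\<close> then occur only in combinations that \<open>low\<close> and
    \<open>dlow\<close> express through \<open>G\<close>.\<close>
  have "24 * fps_X * (1 - fps_X) * (pf * (m * (1 - 5 * fps_X) * fps_deriv G - 5 * m * G
          - 24 * (1 - 2 * fps_X) * fps_deriv G - 24 * fps_X * (1 - fps_X) * fps_deriv (fps_deriv G))
        - 2 * (14 + 2 * fps_X) * (m * (1 - 5 * fps_X) * G - 24 * fps_X * (1 - fps_X) * fps_deriv G))
      + ((m - 6) * pe - 6 * (m - 12) * fps_X * (1 - fps_X) * (7 + fps_X))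
        * (m * (1 - 5 * fps_X) * G - 24 * fps_X * (1 - fps_X) * fps_deriv G)
      = m * (m - 6) * pf ^ 2 * G"
    using low dlow up by algebra
  \<comment> \<open>The eliminated relation is the wanted equation times a nonzero
    polynomial.\<close>
  then have "144 * fps_X * (1 - fps_X) ^ 2 * ?ode = 0"
    unfolding m G_def[symmetric] pe_def pf_def by algebra
  moreover have "fps_X * (1 - fps_X) ^ 2 \<noteq> (0 :: complex fps)"
    by (auto simp: fps_eq_iff[of "1 - fps_X"] intro!: exI[of _ 0])
  ultimately show ?thesis
    by (simp add: mult.assoc)
qed

section \<open>Three-term recurrence of the Taylor coefficients\<close>

definition oct_rec :: "complex \<Rightarrow> (nat \<Rightarrow> complex) \<Rightarrow> bool" where
  "oct_rec N g \<longleftrightarrow> (\<forall>k.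
     (of_nat k + 1) * (4 * of_nat k + 3) * g (Suc k)
     + (14 * of_nat k * (4 * of_nat k - 12 * N - 1) + 9 * N * (12 * N + 1)) * g k
     + (of_nat k - 3 * N - 1) * (4 * of_nat k - 12 * N - 5) * (if k = 0 then 0 else g (k - 1)) = 0)"

lemma oct_rec_octG:
  assumes "1 + 12 * N \<noteq> 0"
  shows "oct_rec N (fps_nth (octG N))"
  unfolding oct_rec_def
proof
  fix k :: nat
  define G where "G = octG N"
  define G1 where "G1 = fps_deriv G"
  define G2 where "G2 = fps_deriv G1"
  define A B D where "A = 42 - 168 * N" and "B = 3 - 24 * N" and "D = 3 * N * (12 * N + 1)"
  have A: "14 * (3 - 12 * fps_const N) = fps_const A" and B: "3 - 24 * fps_const N = fps_const B"
    and D: "3 * fps_const N * (12 * fps_const N + 1) = fps_const D"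
    and D3: "9 * fps_const N * (12 * fps_const N + 1) = fps_const (3 * D)"
    by (simp_all add: A_def B_def D_def numeral_fps_const algebra_simps flip: fps_const_1_eq_1)
  have "4 * (fps_X * G2) + 56 * (fps_X * (fps_X * G2)) + 4 * (fps_X * (fps_X * (fps_X * G2)))
      + 3 * G1 + fps_const A * (fps_X * G1) + fps_const B * (fps_X * (fps_X * G1))
      + fps_const (3 * D) * G + fps_const D * (fps_X * G) = 0"
    using octG_ode[OF assms] unfolding A B D D3 pf_def G_def G1_def G2_def
    by (simp add: algebra_simps power2_eq_square)
  then have E: "(4 * (fps_X * G2) + 56 * (fps_X * (fps_X * G2)) + 4 * (fps_X * (fps_X * (fps_X * G2)))
      + 3 * G1 + fps_const A * (fps_X * G1) + fps_const B * (fps_X * (fps_X * G1))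
      + fps_const (3 * D) * G + fps_const D * (fps_X * G)) $ k = 0"
    by simp
  \<comment> \<open>Up to three factors \<open>fps_X\<close> precede a series, so the index shifts
    are uniform only from \<open>k = 3\<close> on.\<close>
  consider "k = 0" | "k = 1" | "k = 2" | j where "k = Suc (Suc (Suc j))"
    by (metis One_nat_def Suc_1 not0_implies_Suc)
  then show "(of_nat k + 1) * (4 * of_nat k + 3) * octG N $ Suc k
     + (14 * of_nat k * (4 * of_nat k - 12 * N - 1) + 9 * N * (12 * N + 1)) * octG N $ k
     + (of_nat k - 3 * N - 1) * (4 * of_nat k - 12 * N - 5) * (if k = 0 then 0 else octG N $ (k - 1)) = 0"
    using E unfolding G_def[symmetric]
    by cases (simp_all add: G2_def G1_def A_def B_def D_def eval_nat_numeral(2) fps_numeral_nth, simp_all add: algebra_simps)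
qed

text \<open>The induction step shared by the uniqueness proofs for both recurrences.\<close>

lemma three_term_cancel:
  fixes A B C :: complex
  assumes "A * x + B * y + C * z = 0" "A * x' + B * y' + C * z' = 0" "y = y'" "z = z'" "A \<noteq> 0"
  shows "x = x'"
proof -
  have "A * x + (B * y + C * z) = A * x' + (B * y + C * z)"
    using assms(1-4) by (simp add: add.assoc)
  then show ?thesis
    using assms(5) by simp
qed

lemma oct_rec_unique:
  assumes "oct_rec N f" "oct_rec N g" "f 0 = g 0"
  shows "f = g"
proof
  fix k
  show "f k = g k"
  proof (induction k rule: less_induct)
    case (less k)
    show ?case
    proof (cases k)
      case (Suc j)
      have "(of_nat j + 1) * (4 * of_nat j + 3) \<noteq> (0 :: complex)"
      proof -
        have "of_nat ((j + 1) * (4 * j + 3)) \<noteq> (0 :: complex)"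
          by (subst of_nat_eq_0_iff) simp
        then show ?thesis
          by (simp only: of_nat_mult of_nat_add of_nat_numeral of_nat_1 not_False_eq_True)
      qed
      moreover have "f j = g j" "(if j = 0 then 0 else f (j - 1)) = (if j = 0 then 0 else g (j - 1))"
        using less Suc by auto
      ultimately have "f (Suc j) = g (Suc j)"
        by (intro three_term_cancel[OF assms(1,2)[unfolded oct_rec_def, rule_format, of j]])
      then show ?thesis
        using Suc by simp
    qed (use assms in simp)
  qed
qed

lemma octG_nth_0: "octG N $ 0 = 1"
  by (simp add: octG_def pe_powr_def hypF_def octR_nth_0 pe_nth_0)

text \<open>The series 1 solves the recurrence for \<open>N = 0\<close> as well: 9 N (12 N + 1)
  vanishes at k = 0 and the factor k - 3 N - 1 at k = 1.\<close>

lemma octG_0: "octG 0 = 1"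
proof -
  have "oct_rec 0 (fps_nth (octG 0))"
    by (rule oct_rec_octG) simp
  moreover have "oct_rec 0 (fps_nth 1)"
    unfolding oct_rec_def
  proof
    fix k :: nat
    consider "k = 0" | "k = 1" | j where "k = Suc (Suc j)"
      by (metis One_nat_def not0_implies_Suc)
    then show "(of_nat k + 1) * (4 * of_nat k + 3) * (1 :: complex fps) $ Suc k
        + (14 * of_nat k * (4 * of_nat k - 12 * 0 - 1) + 9 * 0 * (12 * 0 + 1)) * (1 :: complex fps) $ k
        + (of_nat k - 3 * 0 - 1) * (4 * of_nat k - 12 * 0 - 5) * (if k = 0 then 0 else (1 :: complex fps) $ (k - 1)) = 0"
      by cases auto
  qed
  ultimately have "fps_nth (octG 0) = fps_nth 1"
    by (rule oct_rec_unique) (simp add: octG_nth_0)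
  then show ?thesis
    by (simp add: fps_eq_iff)
qed

text \<open>Applied with \<open>b = 12\<close> to show that 1 + 12 n, 7 + 12 n and 13 + 12 n do not
  vanish.\<close>

lemma int_combination_ne_0: "(of_int a + of_int b * of_int n :: complex) \<noteq> 0" if "\<not> b dvd a"
proof -
  have "a + b * n \<noteq> 0"
    using that by (metis add_eq_0_iff dvd_minus_iff dvd_triv_left)
  then have "of_int (a + b * n) \<noteq> (0 :: complex)"
    by (simp only: of_int_eq_0_iff not_False_eq_True)
  then show ?thesis
    by (simp only: of_int_add of_int_mult not_False_eq_True)
qed

section \<open>From formal series to analytic functions near u = 0\<close>

lemma octG_has_fps_expansion:
  fixes n :: int
  defines "N \<equiv> of_int n"
  shows "(\<lambda>u. p_e u powr (1 / 12 + N) * gauss_2F1 (- 1 / 24 - N / 2) (11 / 24 - N / 2) (3 / 4) (oct_R u))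
    has_fps_expansion octG N"
proof -
  \<comment> \<open>24 times each hypergeometric parameter has the form a + b n; if the parameter
    were an integer, \<open>gcd b 24\<close> would divide \<open>a\<close>.\<close>
  have nn: "x \<notin> \<int>\<^sub>\<le>\<^sub>0" if "24 * x = of_int a + of_int b * of_int n" "\<not> gcd b 24 dvd a" for x :: complex and a b
  proof
    assume "x \<in> \<int>\<^sub>\<le>\<^sub>0"
    then obtain m where "x = of_int m"
      by (auto elim: nonpos_Ints_cases)
    then have "of_int (24 * m) = (of_int (a + b * n) :: complex)"
      using that by simp
    then have "24 * m = a + b * n"
      by (simp only: of_int_eq_iff)
    then have "a = 24 * m - b * n"
      by simp
    then have "gcd b 24 dvd a"
      by (simp add: dvd_diff)
    with that show False by simp
  qed
  have "- 1 / 24 - N / 2 \<notin> \<int>\<^sub>\<le>\<^sub>0" "11 / 24 - N / 2 \<notin> \<int>\<^sub>\<le>\<^sub>0" "(3 / 4 :: complex) \<notin> \<int>\<^sub>\<le>\<^sub>0"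
    by (rule nn[of _ "- 1" "- 12"] nn[of _ 11 "- 12"] nn[of _ 18 0]; simp add: N_def field_simps)+
  then have "fps_conv_radius (hypF N) > 0"
    unfolding hypF_def by (simp add: fps_conv_radius_2F1)
  then have F: "gauss_2F1 (- 1 / 24 - N / 2) (11 / 24 - N / 2) (3 / 4) has_fps_expansion hypF N"
    by (simp add: gauss_2F1_def hypF_def eval_fps_has_fps_expansion)
  have pe: "p_e has_fps_expansion pe"
  proof -
    have "(\<lambda>u. (1 + u) * (1 - 34 * u + u ^ 2)) has_fps_expansion pe"
      unfolding pe_def by (intro fps_expansion_intros)
    then show ?thesis by (simp add: p_e_def[abs_def])
  qed
  have pv: "(\<lambda>u. - 108 * p_v u) has_fps_expansion - 108 * pv"
  proof -
    have "(\<lambda>u. (- 108) * (u * (1 - u) ^ 4)) has_fps_expansion (fps_const (- 108)) * pv"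
      unfolding pv_def by (intro fps_expansion_intros)
    then show ?thesis by (simp add: p_v_def[abs_def] numeral_fps_const)
  qed
  have R: "oct_R has_fps_expansion octR"
    unfolding oct_R_def[abs_def] octR_def
    by (intro fps_expansion_intros pe pv) (simp add: pe_nth_0)
  have "((\<lambda>x. (1 + x) powr (1 / 12 + N)) \<circ> (\<lambda>u. p_e u - 1)) has_fps_expansion pe_powr (1 / 12 + N)"
    unfolding pe_powr_def
    by (intro fps_expansion_intros pe) (simp add: pe_nth_0)
  then have E: "(\<lambda>u. p_e u powr (1 / 12 + N)) has_fps_expansion pe_powr (1 / 12 + N)"
    by (simp add: o_def)
  have K: "(gauss_2F1 (- 1 / 24 - N / 2) (11 / 24 - N / 2) (3 / 4) \<circ> oct_R) has_fps_expansion (hypF N oo octR)"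
    by (intro has_fps_expansion_compose F R octR_nth_0)
  show ?thesis
    using has_fps_expansion_mult[OF E K] by (simp add: octG_def o_def)
qed

subsection \<open>Local solutions of the Heun equation\<close>

text \<open>The coefficient of z^k in the Heun equation multiplied by z (z - 1) (z - a); the
  conditional stands for a zero coefficient of index -1.\<close>

definition heun_rec ::
  "complex \<Rightarrow> complex \<Rightarrow> complex \<Rightarrow> complex \<Rightarrow> complex \<Rightarrow> complex \<Rightarrow> (nat \<Rightarrow> complex) \<Rightarrow> bool"
where
  "heun_rec a q \<alpha> \<beta> \<gamma> \<delta> f \<longleftrightarrow> (let \<epsilon> = \<alpha> + \<beta> + 1 - \<gamma> - \<delta> in \<forall>k.
     a * (of_nat k + 1) * (of_nat k + \<gamma>) * f (Suc k)
     + (- q - of_nat k * ((of_nat k - 1 + \<gamma>) * (1 + a) + \<delta> * a + \<epsilon>)) * f k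
     + (of_nat k - 1 + \<alpha>) * (of_nat k - 1 + \<beta>) * (if k = 0 then 0 else f (k - 1)) = 0)"

lemma heun_rec_unique:
  assumes "heun_rec a q \<alpha> \<beta> \<gamma> \<delta> f" "heun_rec a q \<alpha> \<beta> \<gamma> \<delta> g" "f 0 = g 0" "a \<noteq> 0" "\<gamma> \<notin> \<int>\<^sub>\<le>\<^sub>0"
  shows "f = g"
proof
  fix k
  show "f k = g k"
  proof (induction k rule: less_induct)
    case (less k)
    show ?case
    proof (cases k)
      case (Suc j)
      have "of_nat j + \<gamma> \<noteq> 0"
        using assms(5) by (metis add_eq_0_iff minus_of_nat_in_nonpos_Ints)
      moreover have "(of_nat j + 1 :: complex) \<noteq> 0"
        by (metis of_nat_Suc of_nat_neq_0 add.commute)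
      ultimately have nz: "a * (of_nat j + 1) * (of_nat j + \<gamma>) \<noteq> 0"
        using assms(4) by simp
      have "f j = g j" "(if j = 0 then 0 else f (j - 1)) = (if j = 0 then 0 else g (j - 1))"
        using less Suc by auto
      then have "f (Suc j) = g (Suc j)"
        using nz by (intro three_term_cancel[OF assms(1,2)[unfolded heun_rec_def Let_def, rule_format, of j]])
      then show ?thesis
        using Suc by simp
    qed (use assms in simp)
  qed
qed

lemma heun_equation_mult:
  fixes a q \<alpha> \<beta> \<gamma> \<delta> z :: complex
  assumes "z \<noteq> 0" "z \<noteq> 1" "z \<noteq> a"
  defines "\<epsilon> \<equiv> \<alpha> + \<beta> + 1 - \<gamma> - \<delta>"
  shows "heun_equation a q \<alpha> \<beta> \<gamma> \<delta> w z \<longleftrightarrow>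
    z * (z - 1) * (z - a) * deriv (deriv w) z
    + (\<gamma> * ((z - 1) * (z - a)) + \<delta> * (z * (z - a)) + \<epsilon> * (z * (z - 1))) * deriv w z
    + (\<alpha> * \<beta> * z - q) * w z = 0"
proof -
  define Z where "Z = z * (z - 1) * (z - a)"
  define S where "S = \<gamma> / z + \<delta> / (z - 1) + \<epsilon> / (z - a)"
  have nz: "Z \<noteq> 0"
    using assms by (simp add: Z_def)
  have "Z * S = \<gamma> * ((z - 1) * (z - a)) + \<delta> * (z * (z - a)) + \<epsilon> * (z * (z - 1))"
  proof -
    have "x * y * v * (\<gamma> / x + \<delta> / y + \<epsilon> / v) = \<gamma> * (y * v) + \<delta> * (x * v) + \<epsilon> * (x * y)"
      if "x \<noteq> 0" "y \<noteq> 0" "v \<noteq> 0" for x y v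
    proof -
      have "x * y * v * (\<gamma> / x + \<delta> / y + \<epsilon> / v)
          = \<gamma> * (y * v) * (x / x) + \<delta> * (x * v) * (y / y) + \<epsilon> * (x * y) * (v / v)"
        by (simp only: distrib_left times_divide_eq_left times_divide_eq_right mult_ac)
      then show ?thesis
        using that by (simp only: divide_self mult_1_right not_False_eq_True)
    qed
    then show ?thesis
      using assms(1-3) unfolding Z_def S_def by simp
  qed
  then have "Z * (deriv (deriv w) z + S * deriv w z + (\<alpha> * \<beta> * z - q) / Z * w z)
      = Z * deriv (deriv w) z
        + (\<gamma> * ((z - 1) * (z - a)) + \<delta> * (z * (z - a)) + \<epsilon> * (z * (z - 1))) * deriv w z
        + (\<alpha> * \<beta> * z - q) * w z"
    using nz by (simp add: distrib_left flip: mult.assoc)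
  then show ?thesis
    using nz unfolding heun_equation_def Let_def \<epsilon>_def[symmetric] S_def[symmetric] Z_def[symmetric]
    by (metis mult_eq_0_iff)
qed

text \<open>Comparison of coefficients. Because \<gamma> + \<delta> + \<epsilon> = \<alpha> +
  \<beta> + 1, the contribution of index k - 1 factors into (k - 1 + \<alpha>) (k - 1 +
  \<beta>).\<close>

lemma heun_fps_iff_rec:
  fixes a q \<alpha> \<beta> \<gamma> \<delta> :: complex and F :: "complex fps"
  defines "\<epsilon> \<equiv> \<alpha> + \<beta> + 1 - \<gamma> - \<delta>" and "X \<equiv> fps_X :: complex fps"
  shows "X * (X - 1) * (X - fps_const a) * fps_deriv (fps_deriv F)
      + (fps_const \<gamma> * ((X - 1) * (X - fps_const a)) + fps_const \<delta> * (X * (X - fps_const a))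
        + fps_const \<epsilon> * (X * (X - 1))) * fps_deriv F
      + (fps_const (\<alpha> * \<beta>) * X - fps_const q) * F = 0 \<longleftrightarrow> heun_rec a q \<alpha> \<beta> \<gamma> \<delta> (fps_nth F)"
    (is "?ode = 0 \<longleftrightarrow> _")
proof -
  define F1 where "F1 = fps_deriv F"
  define F2 where "F2 = fps_deriv F1"
  have ode: "?ode = X * (X * (X * F2)) - fps_const (1 + a) * (X * (X * F2)) + fps_const a * (X * F2)
      + fps_const (\<gamma> + \<delta> + \<epsilon>) * (X * (X * F1)) - fps_const (\<gamma> * (1 + a) + \<delta> * a + \<epsilon>) * (X * F1)
      + fps_const (\<gamma> * a) * F1 + fps_const (\<alpha> * \<beta>) * (X * F) - fps_const q * F"
    unfolding F1_def[symmetric] F2_def[symmetric]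
    by (simp add: algebra_simps flip: fps_const_add fps_const_mult)
  have "?ode $ k = a * (of_nat k + 1) * (of_nat k + \<gamma>) * F $ Suc k
     + (- q - of_nat k * ((of_nat k - 1 + \<gamma>) * (1 + a) + \<delta> * a + \<epsilon>)) * F $ k
     + (of_nat k - 1 + \<alpha>) * (of_nat k - 1 + \<beta>) * (if k = 0 then 0 else F $ (k - 1))" for k
  proof -
    consider "k = 0" | "k = 1" | "k = 2" | j where "k = Suc (Suc (Suc j))"
      by (metis One_nat_def Suc_1 not0_implies_Suc)
    then show ?thesis
      unfolding ode
      by cases (simp_all add: F2_def F1_def X_def \<epsilon>_def eval_nat_numeral(2), simp_all add: algebra_simps)
  qed
  then show ?thesis
    unfolding fps_eq_iff[of ?ode] heun_rec_def Let_def \<epsilon>_def[symmetric] by simp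
qed

text \<open>Cleared of denominators, the equation says \<open>f z = 0\<close> with \<open>f\<close>
  analytic at 0, and \<open>f\<close> vanishes near 0 exactly if its expansion \<open>ode\<close> is
  zero.\<close>

lemma local_heun_solution_iff_rec:
  assumes "w has_fps_expansion F" "a \<noteq> 0"
  shows "local_heun_solution a q \<alpha> \<beta> \<gamma> \<delta> w \<longleftrightarrow> F $ 0 = 1 \<and> heun_rec a q \<alpha> \<beta> \<gamma> \<delta> (fps_nth F)"
proof -
  define \<epsilon> where "\<epsilon> = \<alpha> + \<beta> + 1 - \<gamma> - \<delta>"
  define f where "f z = z * (z - 1) * (z - a) * deriv (deriv w) z
    + (\<gamma> * ((z - 1) * (z - a)) + \<delta> * (z * (z - a)) + \<epsilon> * (z * (z - 1))) * deriv w z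
    + (\<alpha> * \<beta> * z - q) * w z" for z
  define ode where "ode = fps_X * (fps_X - 1) * (fps_X - fps_const a) * fps_deriv (fps_deriv F)
      + (fps_const \<gamma> * ((fps_X - 1) * (fps_X - fps_const a)) + fps_const \<delta> * (fps_X * (fps_X - fps_const a))
        + fps_const \<epsilon> * (fps_X * (fps_X - 1))) * fps_deriv F
      + (fps_const (\<alpha> * \<beta>) * fps_X - fps_const q) * F"
  have f: "f has_fps_expansion ode"
    unfolding f_def[abs_def] ode_def by (intro fps_expansion_intros assms(1))
  have "\<forall>\<^sub>F z in at 0. z \<noteq> (0 :: complex)" "\<forall>\<^sub>F z in at 0. z \<noteq> (1 :: complex)" "\<forall>\<^sub>F z in at 0. z \<noteq> a"
    using assms(2) by (auto intro: eventually_neq_at_within)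
  then have "\<forall>\<^sub>F z in at 0. heun_equation a q \<alpha> \<beta> \<gamma> \<delta> w z \<longleftrightarrow> f z = 0"
    by eventually_elim (simp add: heun_equation_mult f_def \<epsilon>_def)
  then have "(\<forall>\<^sub>F z in at 0. heun_equation a q \<alpha> \<beta> \<gamma> \<delta> w z) \<longleftrightarrow> (\<forall>\<^sub>F z in at 0. f z = 0)"
    by (rule eventually_cong)
  also have "\<dots> \<longleftrightarrow> (\<forall>\<^sub>F z in nhds 0. f z = 0)"
  proof
    \<comment> \<open>The equation is only required off z = 0; continuity of \<open>f\<close>
      supplies the remaining point.\<close>
    assume ev: "\<forall>\<^sub>F z in at 0. f z = 0"
    have "(f \<longlongrightarrow> f 0) (at 0)"
      using has_fps_expansion_imp_continuous[OF f, of UNIV] by (simp add: continuous_within)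
    moreover have "(f \<longlongrightarrow> 0) (at 0)"
      using ev by (simp add: tendsto_eventually)
    ultimately have "f 0 = 0"
      by (rule tendsto_unique[rotated]) simp
    with ev show "\<forall>\<^sub>F z in nhds 0. f z = 0"
      by (simp add: eventually_nhds_conv_at)
  qed (simp add: eventually_nhds_conv_at)
  also have "\<dots> \<longleftrightarrow> ode = 0"
    using f by (metis has_fps_expansion_0_iff fps_expansion_unique_complex)
  also have "\<dots> \<longleftrightarrow> heun_rec a q \<alpha> \<beta> \<gamma> \<delta> (fps_nth F)"
    unfolding ode_def \<epsilon>_def by (rule heun_fps_iff_rec)
  finally have "(\<forall>\<^sub>F z in at 0. heun_equation a q \<alpha> \<beta> \<gamma> \<delta> w z) \<longleftrightarrow> heun_rec a q \<alpha> \<beta> \<gamma> \<delta> (fps_nth F)" .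
  moreover have "w analytic_on {0}"
    using assms(1) by (rule has_fps_expansion_imp_analytic_0)
  moreover have "w 0 = F $ 0"
    using assms(1) by (rule has_fps_expansion_imp_0_eq_fps_nth_0)
  ultimately show ?thesis
    by (simp add: local_heun_solution_def)
qed

text \<open>Resolves the description in \<open>Hn\<close>: the sum of \<open>F\<close> is a
  solution, and any other candidate obeys the same recurrence with the same initial value.\<close>

lemma Hn_eq_eval_fps:
  assumes "fps_conv_radius F > 0" "F $ 0 = 1" "heun_rec a q \<alpha> \<beta> \<gamma> \<delta> (fps_nth F)" "a \<noteq> 0" "\<gamma> \<notin> \<int>\<^sub>\<le>\<^sub>0"
  shows "Hn a q \<alpha> \<beta> \<gamma> \<delta> = eval_fps F"
proof -
  have "(THE F. \<exists>w. local_heun_solution a q \<alpha> \<beta> \<gamma> \<delta> w \<and> w has_fps_expansion F) = F"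
  proof (rule the_equality)
    have "eval_fps F has_fps_expansion F"
      using assms(1) by (rule eval_fps_has_fps_expansion)
    moreover from this have "local_heun_solution a q \<alpha> \<beta> \<gamma> \<delta> (eval_fps F)"
      using assms(2-4) by (simp add: local_heun_solution_iff_rec)
    ultimately show "\<exists>w. local_heun_solution a q \<alpha> \<beta> \<gamma> \<delta> w \<and> w has_fps_expansion F"
      by blast
  next
    fix F' assume "\<exists>w. local_heun_solution a q \<alpha> \<beta> \<gamma> \<delta> w \<and> w has_fps_expansion F'"
    then have "F' $ 0 = 1" "heun_rec a q \<alpha> \<beta> \<gamma> \<delta> (fps_nth F')"
      using assms(4) by (auto simp: local_heun_solution_iff_rec)
    then have "fps_nth F' = fps_nth F"
      using heun_rec_unique[OF _ assms(3) _ assms(4,5)] assms(2) by simp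
    then show "F' = F"
      by (simp add: fps_eq_iff)
  qed
  then show ?thesis
    by (simp add: Hn_def)
qed

subsection \<open>Rationality and the octahedral functions\<close>

lemma has_fps_expansion_poly: "poly p has_fps_expansion fps_of_poly (p :: complex poly)"
  by (simp add: has_fps_expansion_def)

lemma has_fps_expansion_imp_eventually_eq:
  assumes "f has_fps_expansion F" "g has_fps_expansion F"
  shows "\<forall>\<^sub>F z in nhds 0. f z = g z"
proof -
  have "\<forall>\<^sub>F z in nhds 0. eval_fps F z = f z" "\<forall>\<^sub>F z in nhds 0. eval_fps F z = g z"
    using assms by (simp_all add: has_fps_expansion_def)
  then show ?thesis
    by eventually_elim simp
qed

lemma eventually_poly_ne_0:
  fixes p :: "complex poly"
  assumes "p \<noteq> 0"
  shows "\<forall>\<^sub>F z in at x. poly p z \<noteq> 0"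
  using islimpt_finite[OF poly_roots_finite[OF assms], of x] by (simp add: islimpt_iff_eventually)

text \<open>The polynomial p q' - p' q vanishes near x, so it is zero, and by coprimality
  \<open>q\<close> and \<open>q'\<close> divide each other. The factor relating the two fractions
  has no zeros, so the functions agree at the poles too.\<close>

lemma rational_function_unique:
  assumes "rational_function r" "rational_function r'" "\<forall>\<^sub>F u in at x. r u = r' u"
  shows "r = r'"
proof -
  obtain p q where pq: "q \<noteq> 0" "coprime p q" "\<And>u. r u = poly p u / poly q u"
    using assms(1) unfolding rational_function_def by blast
  obtain p' q' where pq': "q' \<noteq> 0" "coprime p' q'" "\<And>u. r' u = poly p' u / poly q' u"
    using assms(2) unfolding rational_function_def by blast
  have eq: "p * q' = p' * q"
  proof (rule ccontr)
    assume "p * q' \<noteq> p' * q"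
    then have "\<forall>\<^sub>F u in at x. poly (p * q' - p' * q) u \<noteq> 0"
      by (intro eventually_poly_ne_0) simp
    moreover note eventually_poly_ne_0[OF pq(1), of x] eventually_poly_ne_0[OF pq'(1), of x] assms(3)
    ultimately have "\<forall>\<^sub>F u in at x. False"
      by eventually_elim (auto simp: pq(3) pq'(3) field_simps)
    then show False by simp
  qed
  have "q dvd p * q'" "q' dvd p' * q"
    using eq by (metis dvd_triv_right)+
  then have "q dvd q'" "q' dvd q"
    using pq(2) pq'(2) by (simp_all add: coprime_commute coprime_dvd_mult_right_iff)
  then obtain k k' where k: "q' = q * k" "q = q' * k'"
    unfolding dvd_def by blast
  then have "q * (k * k') = q * 1"
    by (metis mult.assoc mult_1_right)
  then have "k * k' = 1"
    using pq(1) by (simp only: mult_cancel_left) simp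
  then have "poly k u * poly k' u = 1" for u
    by (metis poly_mult poly_1)
  then have ku: "poly k u \<noteq> 0" for u
    by (metis mult_zero_left zero_neq_one)
  have "q * p' = q * (k * p)"
    using eq unfolding k(1) by (simp only: mult_ac)
  then have "p' = k * p"
    using pq(1) by (simp only: mult_cancel_left) simp
  then show ?thesis
    using ku by (auto simp: fun_eq_iff pq(3) pq'(3) k(1))
qed

text \<open>The reduced fraction p / q with Taylor series \<open>octG\<close> meets the description
  of r^0_n, and \<open>rational_function_unique\<close> excludes any other function.\<close>

lemma octahedral_r0_eqI:
  assumes "q \<noteq> 0" "coprime p q" and eq: "octG (of_int n) * fps_of_poly q = fps_of_poly p"
  shows "octahedral_r0 n = (\<lambda>u. poly p u / poly q u)"
    and "octahedral_r0 n has_fps_expansion octG (of_int n)"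
proof -
  define N where "N = complex_of_int n"
  define g where "g = (\<lambda>u. gauss_2F1 (- 1 / 24 - N / 2) (11 / 24 - N / 2) (3 / 4) (oct_R u))"
  define r where "r = (\<lambda>u. poly p u / poly q u)"
  \<comment> \<open>A zero of \<open>q\<close> at 0 would be shared by \<open>p\<close>, against
    coprimality; hence p / q is analytic at 0.\<close>
  have q0: "poly q 0 \<noteq> 0"
  proof
    assume "poly q 0 = 0"
    moreover from this have "poly p 0 = 0"
      using arg_cong[OF eq, of "\<lambda>f. f $ 0"] by (simp add: poly_0_coeff_0)
    ultimately have "[:0, 1:] dvd q" "[:0, 1:] dvd p"
      by (simp_all add: poly_eq_0_iff_dvd)
    then have "is_unit [:0, 1 :: complex:]"
      using assms(2) coprime_common_divisor by blast
    then show False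
      by (simp add: is_unit_iff_degree)
  qed
  have "r has_fps_expansion fps_of_poly p / fps_of_poly q"
    unfolding r_def using q0
    by (intro has_fps_expansion_divide' has_fps_expansion_poly) (simp add: poly_0_coeff_0)
  also have "fps_of_poly p / fps_of_poly q = octG N"
    using assms(1) unfolding eq[symmetric] N_def by simp
  finally have r: "r has_fps_expansion octG N" .
  have "\<forall>\<^sub>F u in nhds 0. p_e u powr (1 / 12 + N) * g u = r u"
    using octG_has_fps_expansion[of n] r unfolding g_def N_def
    by (rule has_fps_expansion_imp_eventually_eq)
  moreover have "isCont p_e 0"
    unfolding p_e_def[abs_def] by (intro continuous_intros)
  then have "(p_e \<longlongrightarrow> p_e 0) (nhds 0)"
    by (simp only: isCont_def tendsto_at_iff_tendsto_nhds)
  then have pe: "\<forall>\<^sub>F u in nhds 0. p_e u \<noteq> 0"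
    by (rule tendsto_imp_eventually_ne) (simp add: p_e_def)
  ultimately have g: "\<forall>\<^sub>F u in nhds 0. g u = p_e u powr (- 1 / 12 - N) * r u"
  proof eventually_elim
    case (elim u)
    have "p_e u powr (- 1 / 12 - N) * p_e u powr (1 / 12 + N) = 1"
      using elim(2) by (simp flip: powr_add)
    then show ?case
      by (simp flip: elim(1) mult.assoc)
  qed
  have rat: "rational_function r"
    using assms(1,2) unfolding rational_function_def r_def by blast
  have "octahedral_r0 n
      = (THE r. rational_function r \<and> (\<forall>\<^sub>F u in nhds 0. g u = p_e u powr (- 1 / 12 - N) * r u))"
    by (simp add: octahedral_r0_def g_def N_def)
  also have "\<dots> = r"
  proof (rule the_equality)
    show "rational_function r \<and> (\<forall>\<^sub>F u in nhds 0. g u = p_e u powr (- 1 / 12 - N) * r u)"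
      using rat g by simp
  next
    fix r' assume r': "rational_function r' \<and> (\<forall>\<^sub>F u in nhds 0. g u = p_e u powr (- 1 / 12 - N) * r' u)"
    then have "\<forall>\<^sub>F u in nhds 0. g u = p_e u powr (- 1 / 12 - N) * r' u"
      by simp
    with g pe have "\<forall>\<^sub>F u in nhds 0. r' u = r u"
      by eventually_elim (simp add: powr_def)
    then have "\<forall>\<^sub>F u in at 0. r' u = r u"
      by (simp add: eventually_nhds_conv_at)
    then show "r' = r"
      using r' rat rational_function_unique by blast
  qed
  finally have "octahedral_r0 n = r" .
  then show "octahedral_r0 n = (\<lambda>u. poly p u / poly q u)" "octahedral_r0 n has_fps_expansion octG (of_int n)"
    using r by (simp_all add: r_def N_def)
qed

section \<open>Rationality for every integer index\<close>

definition fps_rational :: "complex fps \<Rightarrow> bool" where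
  "fps_rational F \<longleftrightarrow> (\<exists>p q. q \<noteq> 0 \<and> F * fps_of_poly q = fps_of_poly p)"

lemma fps_rational_coprime:
  assumes "fps_rational F"
  obtains p q where "q \<noteq> 0" "coprime p q" "F * fps_of_poly q = fps_of_poly p"
proof -
  obtain p q where pq: "q \<noteq> 0" "F * fps_of_poly q = fps_of_poly p"
    using assms unfolding fps_rational_def by blast
  define d where "d = gcd p q"
  have d: "p = (p div d) * d" "q = (q div d) * d" "d \<noteq> 0"
    using pq(1) by (simp_all add: d_def)
  then have "fps_of_poly d * (F * fps_of_poly (q div d)) = fps_of_poly d * fps_of_poly (p div d)"
    using pq(2) by (metis fps_of_poly_mult mult.commute mult.left_commute)
  then have "F * fps_of_poly (q div d) = fps_of_poly (p div d)"
    using d(3) by (simp add: fps_of_poly_eq_iff[of d 0, simplified])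
  moreover have "coprime (p div d) (q div d)"
    unfolding d_def using pq(1) by (intro div_gcd_coprime) simp
  moreover have "q div d \<noteq> 0"
    using d pq(1) by fastforce
  ultimately show ?thesis
    using that by blast
qed

text \<open>By the quotient rule for F = p / q, the series \<open>G\<close> has the denominator d
  q^2. This carries rationality along the raising and the lowering relation.\<close>

lemma fps_rational_first_order:
  assumes "fps_rational F" "fps_of_poly d * G = fps_of_poly a * fps_deriv F + fps_of_poly b * F" "d \<noteq> 0"
  shows "fps_rational G"
proof -
  obtain p q where pq: "q \<noteq> 0" "F * fps_of_poly q = fps_of_poly p"
    using assms(1) unfolding fps_rational_def by blast
  define P Q P' Q' where "P = fps_of_poly p" and "Q = fps_of_poly q"
    and "P' = fps_of_poly (pderiv p)" and "Q' = fps_of_poly (pderiv q)"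
  have FQ: "F * Q = P"
    using pq(2) by (simp add: P_def Q_def)
  have "P' = fps_deriv F * Q + F * Q'"
    unfolding P'_def Q'_def fps_of_poly_pderiv pq(2)[symmetric] by (simp add: Q_def)
  then have dF: "fps_deriv F * Q * Q = P' * Q - P * Q'"
    by (simp add: algebra_simps flip: FQ)
  have "G * fps_of_poly (d * q * q) = Q * Q * (fps_of_poly d * G)"
    by (simp add: fps_of_poly_mult Q_def mult_ac)
  also have "\<dots> = fps_of_poly a * (fps_deriv F * Q * Q) + fps_of_poly b * (F * Q) * Q"
    unfolding assms(2) by (simp add: algebra_simps)
  also have "\<dots> = fps_of_poly a * (P' * Q - P * Q') + fps_of_poly b * P * Q"
    unfolding dF FQ ..
  also have "\<dots> = fps_of_poly (a * (pderiv p * q - p * pderiv q) + b * p * q)"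
    by (simp add: fps_of_poly_mult fps_of_poly_add fps_of_poly_diff P_def Q_def P'_def Q'_def)
  finally show ?thesis
    using assms(3) pq(1) unfolding fps_rational_def by (intro exI conjI) auto
qed

lemma pf_eq_fps_of_poly: "pf = fps_of_poly [:1, 14, 1:]"
  by (simp add: pf_def fps_of_poly_pCons algebra_simps power2_eq_square numeral_fps_const)

lemma pe_eq_fps_of_poly: "pe = fps_of_poly [:1, - 33, - 33, 1:]"
  by (simp add: pe_def fps_of_poly_pCons algebra_simps power2_eq_square numeral_fps_const)

lemma fps_of_poly_linear_eq: "fps_of_poly [:a, b:] = fps_const a + fps_const b * (fps_X :: complex fps)"
  by (simp add: fps_of_poly_pCons mult.commute)

text \<open>Induction in both directions from \<open>octG_0\<close>: upwards by
  \<open>octG_raise\<close>, downwards by \<open>octG_lower\<close>, whose constants on the left are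
  nonzero at integers.\<close>

lemma fps_rational_octG: "fps_rational (octG (of_int n))"
proof (induction n rule: int_induct[where k = 0])
  case base
  show ?case
    unfolding fps_rational_def by (intro exI[of _ 1]) (simp add: octG_0)
next
  case (step1 i)
  define l m where "l = 7 + 12 * complex_of_int i" and "m = 1 + 12 * complex_of_int i"
  have "l \<noteq> 0"
    using int_combination_ne_0[of 12 7 i] by (simp add: l_def)
  have "fps_of_poly [:l:] * octG (of_int i + 1)
      = fps_of_poly ([:0, 24:] * [:1, - 1:] * [:1, 14, 1:]) * fps_deriv (octG (of_int i))
        + fps_of_poly ([:l:] * [:1, - 33, - 33, 1:] - [:0, 6 * m:] * [:1, - 1:] * [:7, 1:]) * octG (of_int i)"
    using octG_raise[of "of_int i"]
    unfolding fps_of_poly_mult fps_of_poly_diff pf_eq_fps_of_poly[symmetric] pe_eq_fps_of_poly[symmetric]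
      fps_of_poly_linear_eq fps_of_poly_const l_def[symmetric] m_def[symmetric]
    by (simp add: mult_ac numeral_fps_const flip: fps_const_mult fps_const_neg)
  then show ?case
    using step1 \<open>l \<noteq> 0\<close> fps_rational_first_order[of _ "[:l:]"] by simp
next
  case (step2 i)
  define m where "m = 1 + 12 * complex_of_int i"
  have "m \<noteq> 0"
    using int_combination_ne_0[of 12 1 i] by (simp add: m_def)
  have "fps_of_poly ([:m:] * [:1, 14, 1:] ^ 2) * octG (of_int i - 1)
      = fps_of_poly ([:0, - 24:] * [:1, - 1:]) * fps_deriv (octG (of_int i))
        + fps_of_poly ([:m:] * [:1, - 5:]) * octG (of_int i)"
    using octG_lower[of "of_int i"]
    unfolding fps_of_poly_mult fps_of_poly_power pf_eq_fps_of_poly[symmetric]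
      fps_of_poly_linear_eq fps_of_poly_const m_def[symmetric]
    by (simp add: mult_ac numeral_fps_const flip: fps_const_neg)
  then show ?case
    using step2 \<open>m \<noteq> 0\<close> fps_rational_first_order[of _ "[:m:] * [:1, 14, 1:] ^ 2"] by simp
qed

lemma octahedral_r0_has_fps_expansion: "octahedral_r0 n has_fps_expansion octG (of_int n)"
proof -
  obtain p q where "q \<noteq> 0" "coprime p q" "octG (of_int n) * fps_of_poly q = fps_of_poly p"
    using fps_rational_coprime[OF fps_rational_octG] .
  then show ?thesis
    by (rule octahedral_r0_eqI(2))
qed

section \<open>Polynomials of degree 3n for n at least 0\<close>

lemma octG_raise_nth:
  "(7 + 12 * N) * octG (N + 1) $ (k + 3)
    = 24 * (of_nat k + 3) * octG N $ (k + 3) + 312 * (of_nat k + 2) * octG N $ (k + 2)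
      - 312 * (of_nat k + 1) * octG N $ (k + 1) - 24 * of_nat k * octG N $ k
      + (7 + 12 * N) * (octG N $ (k + 3) - 33 * octG N $ (k + 2) - 33 * octG N $ (k + 1) + octG N $ k)
      - 6 * (1 + 12 * N) * (7 * octG N $ (k + 2) - 6 * octG N $ (k + 1) - octG N $ k)"
proof -
  define G l m where "G = octG N" and "l = 7 + 12 * N" and "m = 1 + 12 * N"
  \<comment> \<open>The raising relation expanded with X (1 - X) p_f = X + 13 X^2 - 13 X^3 - X^4, so
    312 = 24 * 13.\<close>
  have "fps_const l * octG (N + 1)
    = 24 * (fps_X * fps_deriv G) + 312 * (fps_X * (fps_X * fps_deriv G))
      - 312 * (fps_X * (fps_X * (fps_X * fps_deriv G))) - 24 * (fps_X * (fps_X * (fps_X * (fps_X * fps_deriv G))))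
      + fps_const l * (G - 33 * (fps_X * G) - 33 * (fps_X * (fps_X * G)) + fps_X * (fps_X * (fps_X * G)))
      - 6 * (fps_const m * (7 * (fps_X * G) - 6 * (fps_X * (fps_X * G)) - fps_X * (fps_X * (fps_X * G))))"
    using octG_raise[of N] unfolding pf_def pe_def G_def[symmetric] l_def[symmetric] m_def[symmetric]
    by algebra
  from arg_cong[OF this, of "\<lambda>F. F $ (k + 3)"] show ?thesis
    unfolding G_def[symmetric] l_def[symmetric] m_def[symmetric]
    by (cases k; simp add: eval_nat_numeral(2) numeral_3_eq_3 fps_numeral_nth) (simp_all add: algebra_simps)
qed

lemma octG_polynomial:
  fixes n :: nat
  shows "octG (of_nat n) $ (3 * n) \<noteq> 0 \<and> (\<forall>k > 3 * n. octG (of_nat n) $ k = 0)"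
proof (induction n)
  case 0
  show ?case by (simp add: octG_0)
next
  case (Suc n)
  define N where "N = complex_of_nat n"
  have l: "7 + 12 * N \<noteq> 0" and m: "13 + 12 * N \<noteq> 0"
    using int_combination_ne_0[of 12 7 "int n"] int_combination_ne_0[of 12 13 "int n"] by (simp_all add: N_def)
  \<comment> \<open>Coefficients beyond index 3n vanish, and the one of index 3n collects -72 N + (7
    + 12 N) + 6 (1 + 12 N) = 13 + 12 N.\<close>
  have "(7 + 12 * N) * octG (N + 1) $ (3 * n + 3) = (13 + 12 * N) * octG N $ (3 * n)"
    unfolding octG_raise_nth using Suc by (simp add: N_def algebra_simps)
  then have "octG (N + 1) $ (3 * n + 3) \<noteq> 0"
    using Suc m by (auto simp: N_def)
  moreover have "octG (N + 1) $ k = 0" if k: "k > 3 * n + 3" for k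
  proof -
    obtain j where j: "k = j + 3" "j > 3 * n"
      using k by (metis add_less_cancel_right le_add_diff_inverse2 less_imp_le_nat le_trans le_add2)
    have "(7 + 12 * N) * octG (N + 1) $ (j + 3) = 0"
      unfolding octG_raise_nth using Suc j(2) by (simp add: N_def)
    then show ?thesis
      using l j(1) by simp
  qed
  ultimately show ?case
    by (simp add: N_def add.commute)
qed

(* Used with t = (2 + sqrt 3)^2; the zeros of p_f are - t and - 1 / t, and u = - z / t moves them
   to z = t^2 and z = 1. *)
lemma heun_rec_scale:
  fixes t N :: complex
  assumes "oct_rec N g" "t ^ 2 - 14 * t + 1 = 0" "t \<noteq> 0"
  shows "heun_rec (t ^ 2) (9 * t * N * (12 * N + 1) / 4) (- 3 * N) (- 1 / 4 - 3 * N) (3 / 4) (- 3 * N)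
    (\<lambda>k. (- 1 / t) ^ k * g k)"
  unfolding heun_rec_def Let_def
proof
  fix k
  define K where "K = complex_of_nat k"
  define g' where "g' = (if k = 0 then 0 else g (k - 1))"
  define c where "c = (- 1 / t) ^ k"
  have e: "- 3 * N + (- 1 / 4 - 3 * N) + 1 - 3 / 4 - - 3 * N = - 3 * N"
    by simp
  have cS: "(- 1 / t) ^ Suc k = - c / t"
    by (simp add: c_def)
  have cP: "(if k = 0 then 0 else (- 1 / t) ^ (k - 1) * g (k - 1)) = - t * c * g'"
    using assms(3) by (cases k) (simp_all add: g'_def c_def)
  have a: "1 + t ^ 2 = 14 * t"
    using assms(2) by (simp add: algebra_simps)
  \<comment> \<open>As \<delta> = \<epsilon>, only 1 + t^2 enters, and this is 14 t; hence the 14 in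
    the octahedral recurrence.\<close>
  have mid: "- (9 * t * N * (12 * N + 1) / 4) - K * ((K - 1 + 3 / 4) * (1 + t ^ 2) + - 3 * N * t ^ 2 + - 3 * N)
      = - (t / 4) * (14 * K * (4 * K - 12 * N - 1) + 9 * N * (12 * N + 1))"
  proof -
    have e2: "K * ((K - 1 + 3 / 4) * (1 + t ^ 2) + - 3 * N * t ^ 2 + - 3 * N)
        = K * ((K - 1 + 3 / 4 - 3 * N) * (1 + t ^ 2))"
      by (simp add: algebra_simps)
    show ?thesis
      unfolding e2 unfolding a by (simp add: algebra_simps add_divide_distrib diff_divide_distrib)
  qed
  have first: "t ^ 2 * (K + 1) * (K + 3 / 4) * (- c / t * x) = - (t * c / 4) * ((K + 1) * (4 * K + 3) * x)" for x
    using assms(3) by (simp add: power2_eq_square)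
  have last: "(K - 1 + - 3 * N) * (K - 1 + (- 1 / 4 - 3 * N)) * (- t * c * x)
      = - (t * c / 4) * ((K - 3 * N - 1) * (4 * K - 12 * N - 5) * x)" for x
    by (simp add: field_simps)
  \<comment> \<open>Each term is the matching term of \<open>oct_rec\<close> times the common factor
    - t c / 4.\<close>
  have "t ^ 2 * (K + 1) * (K + 3 / 4) * (- c / t * g (Suc k))
      + - (t / 4) * (14 * K * (4 * K - 12 * N - 1) + 9 * N * (12 * N + 1)) * (c * g k)
      + (K - 1 + - 3 * N) * (K - 1 + (- 1 / 4 - 3 * N)) * (- t * c * g')
      = - (t * c / 4) * ((K + 1) * (4 * K + 3) * g (Suc k)
        + (14 * K * (4 * K - 12 * N - 1) + 9 * N * (12 * N + 1)) * g k
        + (K - 3 * N - 1) * (4 * K - 12 * N - 5) * g')"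
    unfolding first last distrib_left[of "- (t * c / 4)"] by simp
  also have "\<dots> = 0"
    using assms(1) unfolding oct_rec_def K_def g'_def by simp
  finally show "t ^ 2 * (of_nat k + 1) * (of_nat k + 3 / 4) * ((- 1 / t) ^ Suc k * g (Suc k))
      + (- (9 * t * N * (12 * N + 1) / 4) - of_nat k * ((of_nat k - 1 + 3 / 4) * (1 + t ^ 2) + - 3 * N * t ^ 2
          + (- 3 * N + (- 1 / 4 - 3 * N) + 1 - 3 / 4 - - 3 * N))) * ((- 1 / t) ^ k * g k)
      + (of_nat k - 1 + - 3 * N) * (of_nat k - 1 + (- 1 / 4 - 3 * N))
        * (if k = 0 then 0 else (- 1 / t) ^ (k - 1) * g (k - 1)) = 0"
    unfolding e cS cP K_def[symmetric] mid c_def[symmetric] .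
qed

theorem theorem6p3:
  fixes n :: int and s a q \<alpha> \<beta> \<gamma> \<delta> :: complex
  defines "s \<equiv> complex_of_real (sqrt 3)"
  defines "a \<equiv> ((2 + s) / (2 - s)) ^ 2"
    and "q \<equiv> 9 * (2 + s) ^ 2 * of_int n * (12 * of_int n + 1) / 4"
    and "\<alpha> \<equiv> - 3 * of_int n"
    and "\<beta> \<equiv> - 1 / 4 - 3 * of_int n"
    and "\<gamma> \<equiv> 3 / 4"
    and "\<delta> \<equiv> - 3 * of_int n"
  shows "(\<forall>\<^sub>F u in nhds 0. octahedral_r0 n u = Hn a q \<alpha> \<beta> \<gamma> \<delta> (- ((2 + s) ^ 2) * u))
    \<and> (\<exists>c :: int \<Rightarrow> complex.
         c 0 = 1 \<and> c (- 1) = 0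
         \<and> (\<forall>k\<ge>0. of_int ((k + 1) * (4 * k + 3)) * c (k + 1)
               + of_int (14 * k * (4 * k - 12 * n - 1) + 9 * n * (12 * n + 1)) * c k
               + of_int ((k - 3 * n - 1) * (4 * k - 12 * n - 5)) * c (k - 1) = 0)
         \<and> (\<forall>\<^sub>F u in nhds 0. (\<lambda>k. c (int k) * u ^ k) sums octahedral_r0 n u))
    \<and> (n \<ge> 0 \<longrightarrow>
         (\<exists>H P. is_Heun_polynomial a q \<alpha> \<beta> \<gamma> \<delta> H
            \<and> P = pcompose H [:0, - ((2 + s) ^ 2):]
            \<and> degree P = nat (3 * n)
            \<and> (\<forall>u. octahedral_r0 n u = poly P u)))"
proof (intro conjI impI)
  define N where "N = complex_of_int n"
  define t where "t = (2 + s) ^ 2"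
  define G where "G = octG N"
  \<comment> \<open>The Taylor series of r^0_n(- z / t), the candidate for the Heun function in the
    variable z = - t u.\<close>
  define W where "W = G oo (fps_const (- 1 / t) * fps_X)"
  have s2: "s ^ 2 = 3"
    unfolding s_def by (simp flip: of_real_power)
  \<comment> \<open>As 2 - s is the inverse of 2 + s, the singular point a equals t^2.\<close>
  have ts: "(2 + s) * (2 - s) = 1"
    using s2 by (simp add: algebra_simps power2_eq_square)
  then have nz: "2 + s \<noteq> 0" "2 - s \<noteq> 0"
    by auto
  have "t = 7 + 4 * s"
    using s2 unfolding t_def by (simp add: power2_eq_square algebra_simps)
  then have "t ^ 2 - 14 * t + 1 = 16 * s ^ 2 - 48"
    by (simp add: power2_eq_square algebra_simps)
  then have t: "t ^ 2 - 14 * t + 1 = 0" "t \<noteq> 0"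
    using s2 nz by (simp_all add: t_def)
  have "(2 + s) / (2 - s) = t"
    using nz(2) ts unfolding t_def by (simp add: divide_eq_eq power2_eq_square mult.assoc)
  then have a: "a = t ^ 2"
    by (simp add: a_def)
  have m: "1 + 12 * N \<noteq> 0"
    using int_combination_ne_0[of 12 1 n] by (simp add: N_def)
  have g: "oct_rec N (fps_nth G)"
    unfolding G_def by (rule oct_rec_octG[OF m])
  have r: "octahedral_r0 n has_fps_expansion G"
    unfolding G_def N_def by (rule octahedral_r0_has_fps_expansion)
  have W: "W $ k = (- 1 / t) ^ k * G $ k" for k
    unfolding W_def fps_compose_linear by simp
  \<comment> \<open>The radius of convergence of \<open>W\<close> is positive because
    \<open>W\<close> is the expansion of a composite of analytic functions.\<close>
  have "(\<lambda>z. (- 1 / t) * z) has_fps_expansion (fps_const (- 1 / t) * fps_X)"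
    by (intro fps_expansion_intros)
  then have "(octahedral_r0 n \<circ> (\<lambda>z. (- 1 / t) * z)) has_fps_expansion W"
    unfolding W_def by (intro has_fps_expansion_compose r) simp_all
  then have Wr: "fps_conv_radius W > 0"
    by (simp add: has_fps_expansion_def)
  have "heun_rec a q \<alpha> \<beta> \<gamma> \<delta> (fps_nth W)"
    using heun_rec_scale[OF g t]
    unfolding a q_def \<alpha>_def \<beta>_def \<gamma>_def \<delta>_def N_def[symmetric] t_def[symmetric] W[abs_def] .
  moreover have "(3 / 4 :: complex) \<notin> \<int>\<^sub>\<le>\<^sub>0"
    by (auto elim!: nonpos_Ints_cases simp: complex_eq_iff)
  ultimately have Hn: "Hn a q \<alpha> \<beta> \<gamma> \<delta> = eval_fps W"
    using Wr t(2) by (intro Hn_eq_eval_fps) (simp_all add: W G_def octG_nth_0 a \<gamma>_def)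
  \<comment> \<open>The two scalings cancel term by term, so no convergence is involved.\<close>
  have WG: "eval_fps W (- t * u) = eval_fps G u" for u
  proof -
    have "W $ k * (- t * u) ^ k = G $ k * u ^ k" for k
    proof -
      have "W $ k * (- t * u) ^ k = G $ k * ((- 1 / t) * (- t * u)) ^ k"
        by (simp only: W power_mult_distrib mult_ac)
      then show ?thesis
        using t(2) by simp
    qed
    then show ?thesis
      by (simp add: eval_fps_def)
  qed
  have "\<forall>\<^sub>F u in nhds 0. eval_fps G u = octahedral_r0 n u"
    using r by (simp add: has_fps_expansion_def)
  then show "\<forall>\<^sub>F u in nhds 0. octahedral_r0 n u = Hn a q \<alpha> \<beta> \<gamma> \<delta> (- ((2 + s) ^ 2) * u)"
    unfolding Hn t_def[symmetric] WG by (simp add: eq_commute)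

  \<comment> \<open>The extension by 0 to negative indices provides a_{-1} = 0.\<close>
  define c where "c k = (if k < 0 then 0 else G $ nat k)" for k :: int
  have "of_int ((k + 1) * (4 * k + 3)) * c (k + 1)
      + of_int (14 * k * (4 * k - 12 * n - 1) + 9 * n * (12 * n + 1)) * c k
      + of_int ((k - 3 * n - 1) * (4 * k - 12 * n - 5)) * c (k - 1) = 0" if k: "k \<ge> 0" for k
  proof -
    obtain j where j: "k = int j"
      using k by (rule nonneg_int_cases)
    have "c (k + 1) = G $ Suc j" "c k = G $ j" "c (k - 1) = (if j = 0 then 0 else G $ (j - 1))"
      by (simp_all add: c_def j nat_add_distrib nat_diff_distrib)
    then show ?thesis
      using g[unfolded oct_rec_def, rule_format, of j] by (simp add: j N_def)
  qed
  moreover have "\<forall>\<^sub>F u in nhds 0. (\<lambda>k. c (int k) * u ^ k) sums octahedral_r0 n u"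
  proof -
    have "\<forall>\<^sub>F u in nhds 0. u \<in> eball 0 (fps_conv_radius G)"
      using r by (intro eventually_nhds_in_open) (simp_all add: has_fps_expansion_def zero_ereal_def)
    moreover have "\<forall>\<^sub>F u in nhds 0. eval_fps G u = octahedral_r0 n u"
      using r by (simp add: has_fps_expansion_def)
    ultimately show ?thesis
    proof eventually_elim
      case (elim u)
      then have "(\<lambda>k. G $ k * u ^ k) sums eval_fps G u"
        by (intro sums_eval_fps) simp
      with elim show ?case
        by (simp add: c_def)
    qed
  qed
  ultimately show "\<exists>c :: int \<Rightarrow> complex.
         c 0 = 1 \<and> c (- 1) = 0
         \<and> (\<forall>k\<ge>0. of_int ((k + 1) * (4 * k + 3)) * c (k + 1)
               + of_int (14 * k * (4 * k - 12 * n - 1) + 9 * n * (12 * n + 1)) * c k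
               + of_int ((k - 3 * n - 1) * (4 * k - 12 * n - 5)) * c (k - 1) = 0)
         \<and> (\<forall>\<^sub>F u in nhds 0. (\<lambda>k. c (int k) * u ^ k) sums octahedral_r0 n u)"
    by (intro exI[of _ c]) (simp add: c_def G_def octG_nth_0)

  assume "n \<ge> 0"
  then obtain d where d: "n = int d"
    by (rule nonneg_int_cases)
  \<comment> \<open>The bound 3d + 1 keeps the indices 0 to 3d. \<open>H\<close> undoes the scaling,
    so that substituting - t u into it returns \<open>P\<close>.\<close>
  define P where "P = truncate_fps (3 * d + 1) G"
  define H where "H = pcompose P [:0, - 1 / t:]"
  have Gd: "G $ (3 * d) \<noteq> 0" "\<And>k. k > 3 * d \<Longrightarrow> G $ k = 0"
    using octG_polynomial[of d] by (simp_all add: G_def N_def d)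
  then have P: "fps_of_poly P = G"
    by (intro fps_ext) (simp add: P_def)
  have "degree P = nat (3 * n)"
  proof -
    have "degree P \<le> 3 * d"
      using degree_truncate_fps[of "3 * d + 1" G] by (simp add: P_def)
    moreover have "3 * d \<le> degree P"
      using Gd by (intro le_degree) (simp add: P_def coeff_truncate_fps)
    ultimately show ?thesis
      by (simp add: d nat_mult_distrib)
  qed
  \<comment> \<open>Denominator 1 in \<open>octahedral_r0_eqI\<close> gives the equality at every
    \<open>u\<close>, not only near 0.\<close>
  moreover have "octahedral_r0 n u = poly P u" for u
    using octahedral_r0_eqI(1)[of 1 P n] P by (simp add: G_def N_def)
  moreover have "P = pcompose H [:0, - ((2 + s) ^ 2):]"
    using t(2) unfolding H_def t_def[symmetric] pcompose_assoc[symmetric] by (simp add: pcompose_pCons)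
  moreover have "is_Heun_polynomial a q \<alpha> \<beta> \<gamma> \<delta> H"
  proof -
    have "fps_of_poly H = W"
      unfolding H_def W_def P[symmetric] by (subst fps_of_poly_pcompose) (simp_all add: fps_of_poly_pCons)
    then show ?thesis
      unfolding is_Heun_polynomial_def Hn by (metis eval_fps_of_poly)
  qed
  ultimately show "\<exists>H P. is_Heun_polynomial a q \<alpha> \<beta> \<gamma> \<delta> H
            \<and> P = pcompose H [:0, - ((2 + s) ^ 2):]
            \<and> degree P = nat (3 * n)
            \<and> (\<forall>u. octahedral_r0 n u = poly P u)"
    by blast
qed

end
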